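(* Let $T$ be a set of $n$ points on the boundary of a closed disk $\Delta$. There exists a family $\mathcal{R}$ of relations $R\subseteq T^2$ with $|\mathcal{R}|=2^{\mathcal{O}(n)}$ such that for every planar digraph $G$ drawn in $\Delta$ with $T\subseteq V(G)$, the connectivity pattern induced by $G$ on $T$ equals $\mathsf{gen}(R)$ for some $R\in\mathcal{R}$.
   Context: For a digraph $G$ and $T\subseteq V(G)$, the connectivity pattern induced by $G$ on $T$ is the relation $P\subseteq T^2$ with $(s,t)\in P$ iff $G$ contains a directed path from $s$ to $t$. Viewing the boundary of $\Delta$ as a circle, for $R\subseteq T^2$ define $\mathsf{gen}(R)\subseteq T^2$ by: $(s,t)\in\mathsf{gen}(R)$ iff for every partition of the circle into two disjoint arcs $X_s,X_t$ (open or closed at either end) with $s\in X_s$ and $t\in X_t$, there exist $s'\in X_s$ and $t'\in X_t$ with $(s',t')\in R$. *)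

theory Defs
  imports
    "HOL-Analysis.Analysis"
    "HOL-Library.Landau_Symbols"
    "Graph_Theory.Arc_Walk"
begin

text \<open>
  A finite digraph drawn without crossings in a region \<open>D\<close> of the plane: the vertices are points
  of \<open>D\<close>, and every arc is itself the curve along which it is drawn, directed from tail to head.
  Loops are allowed (\<^const>\<open>simple_path\<close> admits closed curves), and so are parallel and
  antiparallel arcs, which are drawn as distinct curves.
\<close>

definition drawn_digraph :: "complex set \<Rightarrow> (complex, real \<Rightarrow> complex) pre_digraph \<Rightarrow> bool" where
  "drawn_digraph D G \<longleftrightarrow>
     fin_digraph G \<and> verts G \<subseteq> D \<and>
     (\<forall>e\<in>arcs G. simple_path e \<and> path_image e \<subseteq> D \<and>
        pathstart e = tail G e \<and> pathfinish e = head G e \<and>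
        path_image e \<inter> verts G = {tail G e, head G e}) \<and>
     (\<forall>e\<in>arcs G. \<forall>f\<in>arcs G. e \<noteq> f \<longrightarrow> path_image e \<inter> path_image f \<subseteq> verts G)"

definition connectivity_pattern :: "('a, 'b) pre_digraph \<Rightarrow> 'a set \<Rightarrow> ('a \<times> 'a) set" where
  "connectivity_pattern G T = {(s, t) \<in> T \<times> T. \<exists>p. pre_digraph.apath G s p t}"

definition circle_arc :: "complex \<Rightarrow> real \<Rightarrow> complex set \<Rightarrow> bool" where
  "circle_arc c r X \<longleftrightarrow>
     (\<exists>a b. a < b \<and> b \<le> a + 2 * pi \<and>
        (\<exists>I \<in> {{a<..<b}, {a..<b}, {a<..b}, {a..b}}. X = (\<lambda>\<theta>. c + of_real r * cis \<theta>) ` I))"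

text \<open>
  For \<open>s = t\<close> no partition qualifies, so \<open>gen\<close> contains the diagonal of \<open>T\<close>, in accordance with
  the trivial path from a vertex to itself.
\<close>

definition gen :: "complex \<Rightarrow> real \<Rightarrow> complex set \<Rightarrow> (complex \<times> complex) set \<Rightarrow> (complex \<times> complex) set" where
  "gen c r T R = {(s, t) \<in> T \<times> T.
     \<forall>X\<^sub>s X\<^sub>t. circle_arc c r X\<^sub>s \<and> circle_arc c r X\<^sub>t \<and>
        X\<^sub>s \<union> X\<^sub>t = sphere c r \<and> X\<^sub>s \<inter> X\<^sub>t = {} \<and> s \<in> X\<^sub>s \<and> t \<in> X\<^sub>t \<longrightarrow>
        (\<exists>s'\<in>X\<^sub>s. \<exists>t'\<in>X\<^sub>t. (s', t') \<in> R)}"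

end

theory Submission
  imports Defs
begin

text \<open>
  Two directed paths in a disk whose ends interleave on the boundary share a vertex, so a
  connectivity pattern \<open>P\<close> is a preorder in which crossing pairs \<open>(s, t)\<close> and \<open>(u, v)\<close> force
  \<open>(s, v)\<close> and \<open>(u, t)\<close>. Every such preorder satisfies \<open>P = gen P\<close>, hence all of them together
  can serve as the family, and they only have to be counted.

  Cut the circle open and keep the pairs with \<open>s < t\<close>. For a target \<open>x\<close>, let \<open>m x\<close> be its leftmost
  source. The chords \<open>(m x, x)\<close> do not cross, and neither do the chords joining consecutive
  sources of a target. A point \<open>s\<close> with \<open>m x \<le> s < x\<close> fails to reach \<open>x\<close> iff it lies strictly
  below a chord of the second kind within \<open>[m x, x]\<close>, so the two noncrossing chord sets determine
  the pattern, and a noncrossing chord set on \<open>n\<close> points can be encoded in \<open>O(n)\<close> bits.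
\<close>

section \<open>Noncrossing chords and forward patterns\<close>

definition noncrossing :: "'a::linorder set \<Rightarrow> ('a \<times> 'a) set set" where
  "noncrossing V = {h. h \<subseteq> V \<times> V \<and> (\<forall>(a, b) \<in> h. a < b) \<and>
     (\<forall>a b c d. (a, c) \<in> h \<and> (b, d) \<in> h \<longrightarrow> \<not> (a < b \<and> b < c \<and> c < d))}"

text \<open>Marks where a start is closed in a left-to-right scan. When right ends have unique left
  ends, the mark also tells which start it closes.\<close>

definition last_ends :: "('a::linorder \<times> 'a) set \<Rightarrow> 'a set" where
  "last_ends h = {b. \<exists>a. (a, b) \<in> h \<and> (\<forall>c. (a, c) \<in> h \<longrightarrow> c \<le> b)}"

lemma noncrossingI:
  assumes "h \<subseteq> V \<times> V" "\<And>a b. (a, b) \<in> h \<Longrightarrow> a < b"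
    and "\<And>a b c d. (a, c) \<in> h \<Longrightarrow> (b, d) \<in> h \<Longrightarrow> a < b \<Longrightarrow> b < c \<Longrightarrow> c < d \<Longrightarrow> False"
  shows "h \<in> noncrossing V"
  using assms unfolding noncrossing_def by blast

lemma noncrossingD:
  assumes "h \<in> noncrossing V"
  shows "(a, b) \<in> h \<Longrightarrow> a \<in> V" "(a, b) \<in> h \<Longrightarrow> b \<in> V" "(a, b) \<in> h \<Longrightarrow> a < b"
    "(a, c) \<in> h \<Longrightarrow> (b, d) \<in> h \<Longrightarrow> a < b \<Longrightarrow> b < c \<Longrightarrow> \<not> c < d"
  using assms unfolding noncrossing_def by blast+

lemma noncrossing_subset: "h \<in> noncrossing V \<Longrightarrow> k \<subseteq> h \<Longrightarrow> k \<in> noncrossing V"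
  unfolding noncrossing_def by blast

lemma finite_noncrossing: "finite V \<Longrightarrow> finite (noncrossing V)"
  by (rule finite_subset[of _ "Pow (V \<times> V)"]) (auto simp: noncrossing_def)

text \<open>Scanning the points from left to right, the left end of the chord ending at \<open>x\<close> is the nearest
  start that is still open. Hence the starts, the ends and the last ends determine the chords.\<close>

lemma noncrossing_start_not_less:
  fixes h h' :: "('a::linorder \<times> 'a) set"
  assumes V: "finite V" and h: "h \<in> noncrossing V" "single_valued (h\<inverse>)"
    and h': "h' \<in> noncrossing V" "single_valued (h'\<inverse>)"
    and code: "Domain h = Domain h'" "last_ends h = last_ends h'"
    and IH: "\<And>z q. z < x \<Longrightarrow> (q, z) \<in> h \<Longrightarrow> (q, z) \<in> h'"
    and p: "(p, x) \<in> h" and q: "(q, x) \<in> h'"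
  shows "\<not> p < q"
proof
  assume "p < q"
  have "q < x" using noncrossingD(3)[OF h'(1)] q by blast
  let ?E = "{z. (q, z) \<in> h}"
  have fin: "finite ?E"
    using noncrossingD(2)[OF h(1)] by (intro finite_subset[OF _ V]) auto
  have "?E \<noteq> {}" using q code(1) by blast
  \<comment> \<open>\<open>q\<close> starts chords in \<open>h\<close> too. Its last end
    \<open>z\<close> there is not \<open>x\<close>, whose left end is \<open>p\<close>, and not
    beyond \<open>x\<close>, as \<open>(q, z)\<close> would then cross \<open>(p, x)\<close>. So
    \<open>q\<close> is closed before \<open>x\<close> in \<open>h\<close>, and by the equal codes
    also in \<open>h'\<close>.\<close>
  define z where "z = Max ?E"
  have z: "(q, z) \<in> h" and zmax: "\<And>c. (q, c) \<in> h \<Longrightarrow> c \<le> z"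
    using Max_in[OF fin \<open>?E \<noteq> {}\<close>] Max_ge[OF fin] by (auto simp: z_def)
  have "z \<noteq> x" using z p h(2) \<open>p < q\<close> by (auto simp: single_valued_def)
  moreover have "\<not> x < z"
    using noncrossingD(4)[OF h(1) p z] \<open>p < q\<close> \<open>q < x\<close> by blast
  ultimately have "z < x" by simp
  then have z': "(q, z) \<in> h'" using IH z by blast
  have "z \<in> last_ends h'" using z zmax code(2) unfolding last_ends_def by blast
  then obtain a where a: "(a, z) \<in> h'" "\<And>c. (a, c) \<in> h' \<Longrightarrow> c \<le> z"
    unfolding last_ends_def by blast
  have "a = q" using a(1) z' h'(2) by (auto simp: single_valued_def)
  then have "x \<le> z" using a(2) q by blast
  then show False using \<open>z < x\<close> by simp
qed

text \<open>A single-valued converse gives each right end one left end, while left ends may be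
  shared; this is the case that the scan decodes.\<close>

definition noncrossing_fun :: "'a::linorder set \<Rightarrow> ('a \<times> 'a) set set" where
  "noncrossing_fun V = {h \<in> noncrossing V. single_valued (h\<inverse>)}"

text \<open>Induction on the rank of the right end \<open>x\<close>. Equal ranges decide whether
  \<open>x\<close> ends a chord in both sets, and the scan argument, used in both directions,
  excludes different left ends.\<close>

lemma noncrossing_fun_eqI:
  fixes h h' :: "('a::linorder \<times> 'a) set"
  assumes V: "finite V" and h: "h \<in> noncrossing_fun V" and h': "h' \<in> noncrossing_fun V"
    and code: "Domain h = Domain h'" "Range h = Range h'" "last_ends h = last_ends h'"
  shows "h = h'"
proof -
  note hs = h[unfolded noncrossing_fun_def, simplified] h'[unfolded noncrossing_fun_def, simplified]
  have "\<forall>p. (p, x) \<in> h \<longleftrightarrow> (p, x) \<in> h'" for x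
  proof (induction "card {v \<in> V. v < x}" arbitrary: x rule: less_induct)
    case less
    have IH: "(p, z) \<in> h \<longleftrightarrow> (p, z) \<in> h'" if "z < x" for p z
    proof (cases "z \<in> V")
      case True
      have "{v \<in> V. v < z} \<subset> {v \<in> V. v < x}" using that True by auto
      then have "card {v \<in> V. v < z} < card {v \<in> V. v < x}"
        using V by (intro psubset_card_mono) auto
      then show ?thesis using less by blast
    next
      case False
      then show ?thesis using noncrossingD(2) hs by blast
    qed
    have *: "p = q" if p: "(p, x) \<in> h" and q: "(q, x) \<in> h'" for p q
    proof -
      have "\<not> p < q"
        by (rule noncrossing_start_not_less[OF V _ _ _ _ code(1,3) _ p q]) (use hs IH in auto)
      moreover have "\<not> q < p"
        by (rule noncrossing_start_not_less[OF V _ _ _ _ code(1,3)[symmetric] _ q p]) (use hs IH in auto)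
      ultimately show ?thesis by simp
    qed
    have "x \<in> Range h \<longleftrightarrow> x \<in> Range h'" using code(2) by simp
    then show ?case using * by (metis RangeE RangeI)
  qed
  then show ?thesis by auto
qed

text \<open>The code consists of three subsets of \<open>V\<close>, hence a factor 2 * 2 * 2 per
  point.\<close>

lemma card_noncrossing_fun:
  assumes "finite V"
  shows "card (noncrossing_fun V) \<le> 8 ^ card V"
proof -
  let ?code = "\<lambda>h::('a \<times> 'a) set. (Domain h, Range h, last_ends h)"
  have "inj_on ?code (noncrossing_fun V)"
    by (rule inj_onI, rule noncrossing_fun_eqI[OF assms]) simp_all
  moreover have "?code ` noncrossing_fun V \<subseteq> Pow V \<times> Pow V \<times> Pow V"
    by (auto simp: noncrossing_fun_def noncrossing_def last_ends_def)
  ultimately have "card (noncrossing_fun V) \<le> card (Pow V \<times> Pow V \<times> Pow V)"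
    using assms by (intro card_inj_on_le) auto
  also have "\<dots> = (2 * (2 * 2)) ^ card V"
    using assms by (simp only: card_cartesian_product card_Pow power_mult_distrib)
  finally show ?thesis by simp
qed

section \<open>Counting arbitrary noncrossing chord sets\<close>

definition reflect :: "('a::uminus \<times> 'a) set \<Rightarrow> ('a \<times> 'a) set" where
  "reflect h = {(a, b). (- b, - a) \<in> h}"

lemma mem_reflect [simp]: "(a, b) \<in> reflect h \<longleftrightarrow> (- b, - a) \<in> h"
  by (simp add: reflect_def)

lemma reflect_reflect [simp]:
  fixes h :: "('a::group_add \<times> 'a) set" shows "reflect (reflect h) = h"
  by (auto simp: reflect_def)

lemma reflect_noncrossing:
  fixes h :: "('a::linordered_ab_group_add \<times> 'a) set"
  assumes "h \<in> noncrossing V"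
  shows "reflect h \<in> noncrossing (uminus ` V)"
proof (rule noncrossingI)
  show "reflect h \<subseteq> uminus ` V \<times> uminus ` V"
    using noncrossingD(1,2)[OF assms] by (force simp: image_iff)
  show "a < b" if "(a, b) \<in> reflect h" for a b
    using noncrossingD(3)[OF assms] that by fastforce
  show False if "(a, c) \<in> reflect h" "(b, d) \<in> reflect h" "a < b" "b < c" "c < d" for a b c d
    using noncrossingD(4)[OF assms, of "- d" "- b" "- c" "- a"] that by simp
qed

text \<open>At most one chord is longest at a given right end, so these chords lie in
  \<open>noncrossing_fun V\<close>. Reflecting the line does the same for the chords longest at
  their left end. Each half costs a factor 8 per point.\<close>

lemma card_noncrossing:
  fixes V :: "'a::linordered_ab_group_add set"
  assumes "finite V"
  shows "card (noncrossing V) \<le> 64 ^ card V"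
proof -
  let ?f = "\<lambda>(h, k). h \<union> reflect k"
  let ?D = "noncrossing_fun V \<times> noncrossing_fun (uminus ` V)"
  have "h \<in> ?f ` ?D" if h: "h \<in> noncrossing V" for h
  proof -
    define k where "k = {(a, b) \<in> h. \<forall>c. (c, b) \<in> h \<longrightarrow> a \<le> c}"
    define l where "l = {(a, b) \<in> h. \<forall>c. (a, c) \<in> h \<longrightarrow> c \<le> b}"
    \<comment> \<open>A chord that is neither the longest at its left end nor the longest at its right end
      would be enclosed by two crossing chords.\<close>
    have "h \<subseteq> k \<union> l"
    proof (rule ccontr)
      assume "\<not> h \<subseteq> k \<union> l"
      then obtain a b c d where *: "(a, b) \<in> h" "(c, b) \<in> h" "c < a" "(a, d) \<in> h" "b < d"
        unfolding k_def l_def by fastforce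
      then show False
        using noncrossingD(3)[OF h \<open>(a, b) \<in> h\<close>] noncrossingD(4)[OF h \<open>(c, b) \<in> h\<close> \<open>(a, d) \<in> h\<close>]
        by blast
    qed
    then have "h = k \<union> reflect (reflect l)" by (auto simp: k_def l_def)
    moreover have "k \<in> noncrossing_fun V"
      using noncrossing_subset[OF h, of k]
      by (auto simp: noncrossing_fun_def k_def single_valued_def intro: antisym)
    moreover have "reflect l \<in> noncrossing_fun (uminus ` V)"
    proof -
      have "a = c" if "(- b, - a) \<in> l" "(- b, - c) \<in> l" for a b c
      proof -
        have "- a \<le> - c" "- c \<le> - a" using that unfolding l_def by blast+
        then show ?thesis by simp
      qed
      then show ?thesis
        using reflect_noncrossing[OF noncrossing_subset[OF h, of l]]
        by (auto simp: noncrossing_fun_def single_valued_def l_def)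
    qed
    ultimately show ?thesis by (intro image_eqI[where x = "(k, reflect l)"]) simp_all
  qed
  then have "card (noncrossing V) \<le> card ?D"
    using assms
    by (intro surj_card_le[where f = ?f] subsetI) (simp_all add: noncrossing_fun_def finite_noncrossing)
  also have "\<dots> \<le> 8 ^ card V * 8 ^ card V"
    using card_noncrossing_fun[OF assms] card_noncrossing_fun[of "uminus ` V"] assms
    by (auto simp: card_cartesian_product card_image intro!: mult_mono)
  also have "\<dots> = 64 ^ card V" by (simp flip: power_mult_distrib)
  finally show ?thesis .
qed

section \<open>Patterns on a line and their code\<close>

definition forward_patterns :: "'a::linorder set \<Rightarrow> ('a \<times> 'a) set set" where
  "forward_patterns V = {F. F \<subseteq> V \<times> V \<and> (\<forall>(a, b) \<in> F. a < b) \<and> trans F \<and>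
     (\<forall>a b c d. a < b \<and> b < c \<and> c < d \<and> (a, c) \<in> F \<and> (b, d) \<in> F \<longrightarrow> (a, d) \<in> F \<and> (b, c) \<in> F)}"

lemma forward_patternsI:
  assumes "F \<subseteq> V \<times> V" "\<And>a b. (a, b) \<in> F \<Longrightarrow> a < b" "trans F"
    and "\<And>a b c d. a < b \<Longrightarrow> b < c \<Longrightarrow> c < d \<Longrightarrow> (a, c) \<in> F \<Longrightarrow> (b, d) \<in> F \<Longrightarrow> (a, d) \<in> F \<and> (b, c) \<in> F"
  shows "F \<in> forward_patterns V"
  using assms unfolding forward_patterns_def by blast

text \<open>A pattern is encoded by the leftmost source of each point and by the pairs of consecutive
  sources of a common target, the target itself counting as its own last source.\<close>

definition first_sources :: "('a::linorder \<times> 'a) set \<Rightarrow> ('a \<times> 'a) set" where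
  "first_sources F = {(q, x) \<in> F. \<forall>s. (s, x) \<in> F \<longrightarrow> q \<le> s}"

definition source_gaps :: "('a::linorder \<times> 'a) set \<Rightarrow> ('a \<times> 'a) set" where
  "source_gaps F = {(a, b). \<exists>x. (a, x) \<in> F \<and> (b = x \<or> (b, x) \<in> F) \<and> a < b \<and>
     (\<forall>s. a < s \<and> s < b \<longrightarrow> (s, x) \<notin> F)}"

context
  fixes V :: "'a::linorder set" and F
  assumes F: "F \<in> forward_patterns V"
begin

lemma forwardD:
  "(a, b) \<in> F \<Longrightarrow> a \<in> V" "(a, b) \<in> F \<Longrightarrow> b \<in> V" "(a, b) \<in> F \<Longrightarrow> a < b"
  "(a, b) \<in> F \<Longrightarrow> (b, c) \<in> F \<Longrightarrow> (a, c) \<in> F"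
  using F unfolding forward_patterns_def by (blast, blast, blast, blast dest: transD)

lemma forward_cross:
  assumes "a < b" "b < c" "c < d" "(a, c) \<in> F" "(b, d) \<in> F"
  shows "(a, d) \<in> F" "(b, c) \<in> F"
  using F assms unfolding forward_patterns_def by blast+

text \<open>A point between two consecutive sources of \<open>x\<close> reaches nothing beyond this gap, since
  otherwise it would reach \<open>x\<close> by the crossing rule.\<close>

lemma gap_closed:
  assumes "(a, x) \<in> F" "b = x \<or> (b, x) \<in> F" "\<And>s. a < s \<Longrightarrow> s < b \<Longrightarrow> (s, x) \<notin> F"
    and s: "a < s" "s < b" "(s, y) \<in> F"
  shows "y < b"
proof (rule ccontr)
  assume "\<not> y < b"
  have *: "(s, x) \<notin> F" using assms by blast
  have "b \<le> x" using assms(2) forwardD(3) by (auto simp: less_imp_le)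
  \<comment> \<open>Every case makes \<open>s\<close> a source of \<open>x\<close>: through
    \<open>b\<close>, directly, by crossing \<open>(s, y)\<close> with \<open>(b, x)\<close>, or by
    crossing \<open>(a, x)\<close> with \<open>(s, y)\<close>.\<close>
  consider "y = b" | "b < y" "y = x" | "b < y" "y < x" | "x < y"
    using \<open>\<not> y < b\<close> by fastforce
  then show False
  proof cases
    case 1 then show False using * assms(2) forwardD(4) s(3) by blast
  next
    case 2 then show False using * s(3) by blast
  next
    case 3
    then have "(b, x) \<in> F" using assms(2) by auto
    then show False using * 3 s forward_cross(1)[of s b y x] by blast
  next
    case 4 then show False using * s \<open>b \<le> x\<close> assms(1) forward_cross(2)[of a s x y] by auto
  qed
qed

text \<open>If \<open>(a, c)\<close> and \<open>(b, d)\<close> crossed, then \<open>a\<close> would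
  also reach \<open>d\<close> and be an earlier source of it than \<open>b\<close>.\<close>

lemma first_sources_noncrossing: "first_sources F \<in> noncrossing_fun V"
proof -
  have "first_sources F \<in> noncrossing V"
  proof (rule noncrossingI)
    show False if "(a, c) \<in> first_sources F" "(b, d) \<in> first_sources F" "a < b" "b < c" "c < d" for a b c d
      using that forward_cross(1)[of a b c d] unfolding first_sources_def by fastforce
  qed (use forwardD(1-3) in \<open>auto simp: first_sources_def\<close>)
  then show ?thesis
    by (auto simp: noncrossing_fun_def first_sources_def single_valued_def intro: antisym)
qed

text \<open>A gap from \<open>b\<close> to \<open>d\<close> shows that \<open>b\<close> reaches some
  point at or beyond \<open>d\<close>; inside a gap ending at \<open>c < d\<close> this contradicts
  \<open>gap_closed\<close>.\<close>

lemma source_gaps_noncrossing: "source_gaps F \<in> noncrossing V"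
proof (rule noncrossingI)
  show False if ac: "(a, c) \<in> source_gaps F" and bd: "(b, d) \<in> source_gaps F"
    and less: "a < b" "b < c" "c < d" for a b c d
  proof -
    obtain x where "(a, x) \<in> F" "c = x \<or> (c, x) \<in> F" "\<And>s. a < s \<Longrightarrow> s < c \<Longrightarrow> (s, x) \<notin> F"
      using ac unfolding source_gaps_def by blast
    moreover obtain y where "(b, y) \<in> F" "d = y \<or> (d, y) \<in> F"
      using bd unfolding source_gaps_def by blast
    moreover have "d \<le> y" using calculation(5) forwardD(3) by (auto simp: less_imp_le)
    ultimately show False using gap_closed[of a x c b y] less by auto
  qed
qed (use forwardD(1,2) in \<open>auto simp: source_gaps_def\<close>)

text \<open>This is the decoding. Gaps are stored without their targets, but a gap of another target
  does no harm: by \<open>gap_closed\<close> a point under it reaches nothing at or beyond its right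
  end. Conversely, a non-source after the first source lies under a gap of \<open>x\<close>
  itself.\<close>

lemma forward_pattern_eq:
  assumes V: "finite V"
  shows "F = {(s, x). s \<in> V \<and> s < x \<and> (\<exists>q. (q, x) \<in> first_sources F \<and> q \<le> s \<and>
    (\<forall>a b. (a, b) \<in> source_gaps F \<longrightarrow> \<not> (q \<le> a \<and> a < s \<and> s < b \<and> b \<le> x)))}" (is "F = ?R")
proof (intro subset_antisym subrelI)
  fix s x assume sx: "(s, x) \<in> F"
  have fin: "finite {q. (q, x) \<in> F}" using forwardD(1) by (intro finite_subset[OF _ V]) auto
  define q where "q = Min {q. (q, x) \<in> F}"
  have "q \<in> {q. (q, x) \<in> F}" unfolding q_def using fin sx by (intro Min_in) auto
  moreover have min: "q \<le> r" if "(r, x) \<in> F" for r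
    unfolding q_def using that fin by (intro Min_le) auto
  ultimately have "(q, x) \<in> first_sources F" by (auto simp: first_sources_def)
  moreover have "\<not> (a < s \<and> s < b \<and> b \<le> x)" if ab: "(a, b) \<in> source_gaps F" for a b
  proof -
    obtain y where "(a, y) \<in> F" "b = y \<or> (b, y) \<in> F" "\<And>s. a < s \<Longrightarrow> s < b \<Longrightarrow> (s, y) \<notin> F"
      using ab unfolding source_gaps_def by blast
    then show ?thesis using gap_closed[of a y b s x] sx by auto
  qed
  ultimately show "(s, x) \<in> ?R" using forwardD(1,3)[OF sx] min[OF sx] by blast
next
  fix s x assume "(s, x) \<in> ?R"
  then obtain q where s: "s \<in> V" "s < x" and q: "(q, x) \<in> F" "q \<le> s" and
    gaps: "\<And>a b. (a, b) \<in> source_gaps F \<Longrightarrow> \<not> (q \<le> a \<and> a < s \<and> s < b \<and> b \<le> x)"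
    by (auto simp: first_sources_def)
  show "(s, x) \<in> F"
  proof (rule ccontr)
    assume sx: "(s, x) \<notin> F"
    \<comment> \<open>The gap around \<open>s\<close> runs from the nearest source of
      \<open>x\<close> below \<open>s\<close> to the nearest one above, with \<open>x\<close> itself
      as the default.\<close>
    let ?A = "{a. (a, x) \<in> F \<and> a < s}" and ?B = "{b. (b = x \<or> (b, x) \<in> F) \<and> s < b}"
    define a b where "a = Max ?A" and "b = Min ?B"
    have "finite ?A" "finite ?B"
      using forwardD(1,2) q by (auto intro!: finite_subset[OF _ V])
    moreover have "q \<in> ?A" "x \<in> ?B" using q s sx by (auto simp: order.order_iff_strict)
    ultimately have a: "a \<in> ?A" "\<And>r. r \<in> ?A \<Longrightarrow> r \<le> a" and b: "b \<in> ?B" "\<And>r. r \<in> ?B \<Longrightarrow> b \<le> r"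
      unfolding a_def b_def using Max_in[of ?A] Max_ge[of ?A] Min_in[of ?B] Min_le[of ?B] by blast+
    have "(r, x) \<notin> F" if "a < r" "r < b" for r
      using a(2)[of r] b(2)[of r] that sx by (cases r s rule: linorder_cases) auto
    then have "(a, b) \<in> source_gaps F" using a(1) b(1) by (auto simp: source_gaps_def)
    then show False using gaps[of a b] a b \<open>q \<in> ?A\<close> \<open>x \<in> ?B\<close> by auto
  qed
qed

end

text \<open>First sources are unique for each target and cost a factor 8 per point; the gaps cost
  64.\<close>

lemma card_forward_patterns:
  fixes V :: "'a::linordered_ab_group_add set"
  assumes "finite V"
  shows "card (forward_patterns V) \<le> 512 ^ card V"
proof -
  let ?code = "\<lambda>F. (first_sources F, source_gaps F)"
  have "inj_on ?code (forward_patterns V)"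
  proof (rule inj_onI)
    fix F F' assume F: "F \<in> forward_patterns V" "F' \<in> forward_patterns V" "?code F = ?code F'"
    have "first_sources F = first_sources F'" "source_gaps F = source_gaps F'" using F(3) by simp_all
    then show "F = F'"
      by (intro trans[OF forward_pattern_eq[OF F(1) assms]
            trans[OF _ forward_pattern_eq[OF F(2) assms, symmetric]]]) simp
  qed
  moreover have "?code ` forward_patterns V \<subseteq> noncrossing_fun V \<times> noncrossing V"
    by (auto simp: first_sources_noncrossing source_gaps_noncrossing)
  ultimately have "card (forward_patterns V) \<le> card (noncrossing_fun V \<times> noncrossing V)"
    using assms by (intro card_inj_on_le) (auto simp: noncrossing_fun_def finite_noncrossing)
  also have "\<dots> \<le> 8 ^ card V * 64 ^ card V"
    using card_noncrossing_fun[OF assms] card_noncrossing[OF assms]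
    by (auto simp: card_cartesian_product intro!: mult_mono)
  also have "\<dots> = 512 ^ card V" by (simp flip: power_mult_distrib)
  finally show ?thesis .
qed

section \<open>Paths in a disk\<close>

text \<open>Since \<open>s\<close> and \<open>t\<close> are equidistant from \<open>z\<close>, the
  inner product of \<open>s - z\<close> and \<open>s - t\<close> is half the squared length of the
  chord, so moving outward along the chord line increases the distance to \<open>z\<close>.\<close>

lemma ray_from_chord_leaves_disk:
  fixes s t z :: "'a::real_inner"
  assumes "dist z s = r" "dist z t = r" "s \<noteq> t" "0 < j"
  shows "s + j *\<^sub>R (s - t) \<notin> cball z r"
proof -
  have eq: "(s - z) \<bullet> (s - z) = (t - z) \<bullet> (t - z)"
    using assms(1,2) by (metis dist_commute dist_norm power2_norm_eq_inner)
  have "2 * ((s - z) \<bullet> (s - t)) = (s - t) \<bullet> (s - t)"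
    using eq by (simp add: inner_simps algebra_simps inner_commute)
  moreover have "0 < (s - t) \<bullet> (s - t)" using assms(3) by simp
  ultimately have *: "0 < (s - z) \<bullet> (s - t)" by linarith
  have "(norm (s + j *\<^sub>R (s - t) - z))\<^sup>2 =
      (norm (s - z))\<^sup>2 + 2 * j * ((s - z) \<bullet> (s - t)) + j\<^sup>2 * ((s - t) \<bullet> (s - t))"
    unfolding power2_norm_eq_inner
    by (simp add: inner_simps inner_commute power2_eq_square algebra_simps)
  moreover have "0 < 2 * j * ((s - z) \<bullet> (s - t))" using * assms(4) by simp
  moreover have "0 \<le> j\<^sup>2 * ((s - t) \<bullet> (s - t))" by simp
  ultimately have "(norm (s - z))\<^sup>2 < (norm (s + j *\<^sub>R (s - t) - z))\<^sup>2" by linarith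
  then have "norm (s - z) < norm (s + j *\<^sub>R (s - t) - z)" by (rule power2_less_imp_less) simp
  then show ?thesis using assms(1) by (simp add: dist_norm norm_minus_commute)
qed

lemma closed_segment_ray:
  fixes s d :: "'a::real_vector"
  assumes "x \<in> closed_segment s (s + k *\<^sub>R d)" "0 \<le> k"
  obtains j where "0 \<le> j" "j \<le> k" "x = s + j *\<^sub>R d"
proof -
  from assms(1) obtain u where u: "0 \<le> u" "u \<le> 1" "x = (1 - u) *\<^sub>R s + u *\<^sub>R (s + k *\<^sub>R d)"
    unfolding closed_segment_def by blast
  then show ?thesis
    using assms(2) mult_left_le_one_le[of k u] by (intro that[of "u * k"]) (auto simp: algebra_simps)
qed

text \<open>Prepares one path for Fashoda's theorem, which wants ends on opposite sides of a box.
  The linear functional changes sign between \<open>s\<close> and \<open>t\<close>, so it runs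
  monotonically to \<open>- M\<close> and \<open>M\<close> along the outer rays of the
  chord.\<close>

lemma extend_path_along_chord:
  fixes z s t n p :: "'a::real_inner"
  assumes f: "path f" "path_image f \<subseteq> cball z r" "pathstart f = s" "pathfinish f = t"
    and st: "dist z s = r" "dist z t = r"
    and L: "n \<bullet> (s - p) < 0" "0 < n \<bullet> (t - p)"
    and M: "\<And>x. x \<in> cball z r \<Longrightarrow> \<bar>n \<bullet> (x - p)\<bar> \<le> M"
  obtains h where "path h" "n \<bullet> (pathstart h - p) = - M" "n \<bullet> (pathfinish h - p) = M"
    "\<And>x. x \<in> path_image h \<Longrightarrow> x \<in> path_image f \<or>
       (x \<notin> cball z r \<and> n \<bullet> (x - p) \<noteq> 0 \<and> \<bar>n \<bullet> (x - p)\<bar> \<le> M \<and> (\<exists>j. x = s + j *\<^sub>R (t - s)))"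
proof -
  let ?L = "\<lambda>x. n \<bullet> (x - p)"
  have "s \<noteq> t" using L by auto
  have D: "0 < ?L t - ?L s" using L by simp
  have Ms: "- M \<le> ?L s" and Mt: "?L t \<le> M"
    using M[of s] M[of t] st by auto
  \<comment> \<open>The ray lengths, in units of the chord, at which the functional attains
    \<open>- M\<close> and \<open>M\<close>.\<close>
  define k where "k = (M + ?L s) / (?L t - ?L s)"
  define l where "l = (M - ?L t) / (?L t - ?L s)"
  have k: "0 \<le> k" "k * (?L t - ?L s) = M + ?L s" and l: "0 \<le> l" "l * (?L t - ?L s) = M - ?L t"
    using D Ms Mt by (auto simp: k_def l_def)
  have Ls: "?L (s + j *\<^sub>R (s - t)) = ?L s - j * (?L t - ?L s)" for j
    by (simp add: inner_simps algebra_simps)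
  have Lt: "?L (t + j *\<^sub>R (t - s)) = ?L t + j * (?L t - ?L s)" for j
    by (simp add: inner_simps algebra_simps)
  let ?s = "s + k *\<^sub>R (s - t)" and ?t = "t + l *\<^sub>R (t - s)"
  define h where "h = linepath ?s s +++ f +++ linepath t ?t"
  have "path_image h \<subseteq> closed_segment s ?s \<union> path_image f \<union> closed_segment t ?t"
    unfolding h_def using f(3,4) by (simp add: path_image_join closed_segment_commute) blast
  moreover have "x = s \<or> (x \<notin> cball z r \<and> ?L x \<noteq> 0 \<and> \<bar>?L x\<bar> \<le> M \<and> (\<exists>j. x = s + j *\<^sub>R (t - s)))"
    if x: "x \<in> closed_segment s ?s" for x
  proof -
    obtain j where j: "0 \<le> j" "j \<le> k" "x = s + j *\<^sub>R (s - t)"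
      using closed_segment_ray[OF x k(1)] .
    have "0 \<le> j * (?L t - ?L s)" "j * (?L t - ?L s) \<le> k * (?L t - ?L s)"
      using j D by (auto intro: mult_right_mono)
    then have "?L x < 0" "\<bar>?L x\<bar> \<le> M" using L j(3) k(2) Ls[of j] Mt by auto
    moreover have "x = s + (- j) *\<^sub>R (t - s)" using j(3) by (simp add: algebra_simps)
    moreover have "x \<notin> cball z r" if "j \<noteq> 0"
      using ray_from_chord_leaves_disk[OF st \<open>s \<noteq> t\<close>, of j] j that by simp
    ultimately show ?thesis using j(3) by (cases "j = 0") (simp, metis less_irrefl)
  qed
  moreover have "x = t \<or> (x \<notin> cball z r \<and> ?L x \<noteq> 0 \<and> \<bar>?L x\<bar> \<le> M \<and> (\<exists>j. x = s + j *\<^sub>R (t - s)))"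
    if x: "x \<in> closed_segment t ?t" for x
  proof -
    obtain j where j: "0 \<le> j" "j \<le> l" "x = t + j *\<^sub>R (t - s)"
      using closed_segment_ray[OF x l(1)] .
    have "0 \<le> j * (?L t - ?L s)" "j * (?L t - ?L s) \<le> l * (?L t - ?L s)"
      using j D by (auto intro: mult_right_mono)
    then have "0 < ?L x" "\<bar>?L x\<bar> \<le> M" using L j(3) l(2) Lt[of j] Ms by auto
    moreover have "x = s + (1 + j) *\<^sub>R (t - s)" using j(3) by (simp add: algebra_simps)
    moreover have "x \<notin> cball z r" if "j \<noteq> 0"
      using ray_from_chord_leaves_disk[OF st(2,1) \<open>s \<noteq> t\<close>[symmetric], of j] j that by simp
    ultimately show ?thesis using j(3) by (cases "j = 0") (simp, metis less_irrefl)
  qed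
  moreover have "s \<in> path_image f" "t \<in> path_image f"
    using f(3,4) by (metis pathstart_in_path_image, metis pathfinish_in_path_image)
  ultimately have "x \<in> path_image f \<or>
       (x \<notin> cball z r \<and> ?L x \<noteq> 0 \<and> \<bar>?L x\<bar> \<le> M \<and> (\<exists>j. x = s + j *\<^sub>R (t - s)))"
    if "x \<in> path_image h" for x
    using that by blast
  moreover have "path h" unfolding h_def using f by (intro path_join_imp) auto
  moreover have "?L (pathstart h) = - M" "?L (pathfinish h) = M"
    using Ls[of k] Lt[of l] k(2) l(2) by (auto simp: h_def)
  ultimately show ?thesis using that by blast
qed

text \<open>Multiplication by \<open>\<i>\<close> is a quarter turn, so \<open>w\<close> is parallel
  to both \<open>p\<close> and \<open>q\<close>, and these are linearly independent.\<close>

lemma complex_eq_0_if_orthogonal: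
  assumes "(\<i> * p) \<bullet> w = 0" "(\<i> * q) \<bullet> w = 0" "(\<i> * p) \<bullet> q \<noteq> 0"
  shows "w = 0"
proof -
  have eqs: "Re p * Im w = Im p * Re w" "Re q * Im w = Im q * Re w"
    and det: "Re p * Im q - Im p * Re q \<noteq> 0"
    using assms by (auto simp: inner_complex_def)
  have "(Re p * Im q - Im p * Re q) * Re w = 0" "(Re p * Im q - Im p * Re q) * Im w = 0"
    using eqs by algebra+
  then show ?thesis using det by (auto simp: complex_eq_iff)
qed

text \<open>The chords are extended to rays outside the disk, and the signed distances to the two chord
  lines are used as coordinates; then Fashoda's theorem applies in a large box.\<close>

lemma paths_with_crossing_chords_meet:
  fixes z s t u v :: complex
  assumes f: "path f" "path_image f \<subseteq> cball z r" "pathstart f = s" "pathfinish f = t"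
    and g: "path g" "path_image g \<subseteq> cball z r" "pathstart g = u" "pathfinish g = v"
    and sph: "dist z s = r" "dist z t = r" "dist z u = r" "dist z v = r"
    and L1: "(\<i> * (u - v)) \<bullet> (s - u) < 0" "0 < (\<i> * (u - v)) \<bullet> (t - u)"
    and L2: "(\<i> * (t - s)) \<bullet> (u - s) < 0" "0 < (\<i> * (t - s)) \<bullet> (v - s)"
  obtains x where "x \<in> path_image f" "x \<in> path_image g"
proof -
  let ?m = "\<i> * (u - v)" and ?n = "\<i> * (t - s)"
  \<comment> \<open>The first coordinate vanishes on the line through \<open>u\<close> and
    \<open>v\<close>, the second on the line through \<open>s\<close> and \<open>t\<close>; the
    extension of \<open>f\<close> crosses the box horizontally, that of \<open>g\<close>
    vertically.\<close>
  let ?\<Phi> = "\<lambda>x. vector [?m \<bullet> (x - u), ?n \<bullet> (x - s)] :: real^2"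
  have "bounded ((\<lambda>x. ?m \<bullet> (x - u)) ` cball z r)" "bounded ((\<lambda>x. ?n \<bullet> (x - s)) ` cball z r)"
    by (intro compact_imp_bounded compact_continuous_image continuous_intros compact_cball)+
  then obtain M1 M2 where "\<forall>x\<in>cball z r. \<bar>?m \<bullet> (x - u)\<bar> \<le> M1" "\<forall>x\<in>cball z r. \<bar>?n \<bullet> (x - s)\<bar> \<le> M2"
    unfolding bounded_iff by (auto simp del: mem_cball)
  then obtain M where M: "\<And>x. x \<in> cball z r \<Longrightarrow> \<bar>?m \<bullet> (x - u)\<bar> \<le> M"
      "\<And>x. x \<in> cball z r \<Longrightarrow> \<bar>?n \<bullet> (x - s)\<bar> \<le> M"
    using max.coboundedI1 max.coboundedI2 by metis
  have "0 \<le> M" using M(1)[of s] sph by simp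
  obtain h where h: "path h" "?m \<bullet> (pathstart h - u) = - M" "?m \<bullet> (pathfinish h - u) = M"
    and h_cases: "\<And>x. x \<in> path_image h \<Longrightarrow> x \<in> path_image f \<or>
       (x \<notin> cball z r \<and> ?m \<bullet> (x - u) \<noteq> 0 \<and> \<bar>?m \<bullet> (x - u)\<bar> \<le> M \<and> (\<exists>j. x = s + j *\<^sub>R (t - s)))"
    using extend_path_along_chord[OF f sph(1,2) L1 M(1)] by metis
  obtain k where k: "path k" "?n \<bullet> (pathstart k - s) = - M" "?n \<bullet> (pathfinish k - s) = M"
    and k_cases: "\<And>x. x \<in> path_image k \<Longrightarrow> x \<in> path_image g \<or>
       (x \<notin> cball z r \<and> ?n \<bullet> (x - s) \<noteq> 0 \<and> \<bar>?n \<bullet> (x - s)\<bar> \<le> M \<and> (\<exists>j. x = u + j *\<^sub>R (v - u)))"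
    using extend_path_along_chord[OF g sph(3,4) L2 M(2)] by metis
  have orth: "(\<i> * w) \<bullet> (j *\<^sub>R w) = 0" "(\<i> * - w) \<bullet> (j *\<^sub>R w) = 0" for w :: complex and j
    by (simp_all add: inner_complex_def)
  have h0: "?n \<bullet> (x - s) = 0" if "x = s + j *\<^sub>R (t - s)" for x j
    using that orth(1)[of "t - s" j] by simp
  have k0: "?m \<bullet> (x - u) = 0" if "x = u + j *\<^sub>R (v - u)" for x j
    using that orth(2)[of "v - u" j] by simp
  have cont: "continuous_on S ?\<Phi>" for S
  proof (subst continuous_on_componentwise, intro ballI)
    fix i :: "real^2" assume "i \<in> Basis"
    then consider "i = axis 1 1" | "i = axis 2 1" by (auto simp: Basis_vec_def exhaust_2) (metis exhaust_2)
    then show "continuous_on S (\<lambda>x. ?\<Phi> x \<bullet> i)"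
      by cases (auto simp: inner_axis intro!: continuous_intros)
  qed
  have box: "?\<Phi> x \<in> cbox (vector [- M, - M]) (vector [M, M])"
    if "\<bar>?m \<bullet> (x - u)\<bar> \<le> M" "\<bar>?n \<bullet> (x - s)\<bar> \<le> M" for x
    using that by (auto simp: mem_box_cart forall_2)
  have imgh: "path_image (?\<Phi> \<circ> h) \<subseteq> cbox (vector [- M, - M]) (vector [M, M])"
    unfolding path_image_compose
  proof (intro image_subsetI box)
    fix x assume "x \<in> path_image h"
    then show "\<bar>?m \<bullet> (x - u)\<bar> \<le> M" "\<bar>?n \<bullet> (x - s)\<bar> \<le> M"
      using h_cases[of x] h0[of x] M[of x] f(2) \<open>0 \<le> M\<close> by force+
  qed
  have imgk: "path_image (?\<Phi> \<circ> k) \<subseteq> cbox (vector [- M, - M]) (vector [M, M])"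
    unfolding path_image_compose
  proof (intro image_subsetI box)
    fix x assume "x \<in> path_image k"
    then show "\<bar>?m \<bullet> (x - u)\<bar> \<le> M" "\<bar>?n \<bullet> (x - s)\<bar> \<le> M"
      using k_cases[of x] k0[of x] M[of x] g(2) \<open>0 \<le> M\<close> by force+
  qed
  have paths: "path (?\<Phi> \<circ> h)" "path (?\<Phi> \<circ> k)"
    using h(1) k(1) cont by (auto intro: path_continuous_image)
  have ends: "pathstart (?\<Phi> \<circ> h) $ 1 = (vector [- M, - M] :: real^2) $ 1"
    "pathfinish (?\<Phi> \<circ> h) $ 1 = (vector [M, M] :: real^2) $ 1"
    "pathstart (?\<Phi> \<circ> k) $ 2 = (vector [- M, - M] :: real^2) $ 2"
    "pathfinish (?\<Phi> \<circ> k) $ 2 = (vector [M, M] :: real^2) $ 2"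
    using h(2,3) k(2,3) by (simp_all add: pathstart_compose pathfinish_compose)
  obtain w where "w \<in> path_image (?\<Phi> \<circ> h)" "w \<in> path_image (?\<Phi> \<circ> k)"
    by (rule fashoda[OF paths imgh imgk ends])
  then obtain x y where x: "x \<in> path_image h" and y: "y \<in> path_image k" and eq: "?\<Phi> x = ?\<Phi> y"
    unfolding path_image_compose by force
  have "?m \<bullet> (x - u) = ?m \<bullet> (y - u)" "?n \<bullet> (x - s) = ?n \<bullet> (y - s)"
    using arg_cong[OF eq, of "\<lambda>w. w $ 1"] arg_cong[OF eq, of "\<lambda>w. w $ 2"] by simp_all
  then have "?m \<bullet> (x - y) = 0" "?n \<bullet> (x - y) = 0" by (simp_all add: inner_diff_right)
  moreover have "?m \<bullet> (t - s) \<noteq> 0" using L1 by (simp add: inner_diff_right)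
  ultimately have "x = y" using complex_eq_0_if_orthogonal[of "u - v" "x - y" "t - s"] by simp
  \<comment> \<open>A common point outside the disk would lie on both chord lines, so its first
    coordinate would be 0, which the rays extending \<open>f\<close> avoid.\<close>
  then show ?thesis
    using h_cases[OF x] k_cases[of x] y k0[of x] f(2) g(2) that by blast
qed

section \<open>Chords and arcs in angular coordinates\<close>

lemma cis_diff: "cis q - cis p = cis ((p + q) / 2) * (2 * \<i> * of_real (sin ((q - p) / 2)))"
proof -
  have "q = (p + q) / 2 + (q - p) / 2" "p = (p + q) / 2 + - ((q - p) / 2)" by (simp_all add: field_simps)
  then have "cis q - cis p = cis ((p + q) / 2) * (cis ((q - p) / 2) - cis (- ((q - p) / 2)))"
    by (metis cis_mult right_diff_distrib)
  also have "cis ((q - p) / 2) - cis (- ((q - p) / 2)) = 2 * \<i> * of_real (sin ((q - p) / 2))"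
    by (simp add: complex_eq_iff)
  finally show ?thesis .
qed

text \<open>Tells on which side of a chord a third point of the circle lies. In the half-angle
  factorizations the phases combine to \<open>cis ((x - q) / 2)\<close>, whose imaginary part is the
  first sine.\<close>

lemma chord_side:
  "(\<i> * (cis q - cis p)) \<bullet> (cis x - cis p) =
     4 * sin ((x - q) / 2) * sin ((q - p) / 2) * sin ((x - p) / 2)"
proof -
  have inner: "(\<i> * w) \<bullet> y = Im (y * cnj w)" for w y :: complex
    by (simp add: inner_complex_def algebra_simps)
  have rearrange: "(A * (2 * \<i> * S)) * (B * - (2 * \<i> * Q)) = 4 * S * Q * (A * B)" for A B S Q :: complex
    using i_squared by algebra
  have conj: "cnj (cis q - cis p) = cis (- ((p + q) / 2)) * - (2 * \<i> * of_real (sin ((q - p) / 2)))"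
    unfolding cis_diff by (simp add: cis_cnj)
  have product: "(cis x - cis p) * cnj (cis q - cis p) =
     of_real (4 * sin ((x - p) / 2) * sin ((q - p) / 2)) * (cis ((p + x) / 2) * cis (- ((p + q) / 2)))"
    unfolding conj cis_diff[of x p] rearrange by simp
  have cis: "cis ((p + x) / 2) * cis (- ((p + q) / 2)) = cis ((x - q) / 2)"
    by (simp add: cis_mult diff_divide_distrib add_divide_distrib)
  show ?thesis unfolding inner product cis by simp
qed

definition circle_point :: "complex \<Rightarrow> real \<Rightarrow> real \<Rightarrow> complex" where
  "circle_point z r \<theta> = z + of_real r * cis \<theta>"

text \<open>All half differences of the angles lie strictly between \<open>- pi\<close> and
  \<open>pi\<close>, so \<open>chord_side\<close> turns their order into the required signs.\<close>

lemma paths_with_interleaved_ends_meet: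
  assumes r: "0 < r" and less: "a < b" "b < c" "c < d" "d < a + 2 * pi"
    and f: "path f" "path_image f \<subseteq> cball z r"
      "pathstart f = circle_point z r a" "pathfinish f = circle_point z r c"
    and g: "path g" "path_image g \<subseteq> cball z r"
      "pathstart g = circle_point z r b" "pathfinish g = circle_point z r d"
  obtains x where "x \<in> path_image f" "x \<in> path_image g"
proof -
  let ?p = "circle_point z r"
  have side: "(\<i> * (?p j - ?p i)) \<bullet> (?p k - ?p l) = r\<^sup>2 * ((\<i> * (cis j - cis i)) \<bullet> (cis k - cis l))"
    for i j k l
    by (simp add: circle_point_def inner_complex_def power2_eq_square algebra_simps)
  \<comment> \<open>The normal of a chord is orthogonal to the chord, so either end may serve as
    base point.\<close>
  have side': "(\<i> * (?p j - ?p i)) \<bullet> (?p k - ?p j) = (\<i> * (?p j - ?p i)) \<bullet> (?p k - ?p i)"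
    for i j k
    by (simp add: inner_complex_def algebra_simps)
  have sin_pos: "0 < sin ((y - x) / 2)" "sin ((x - y) / 2) < 0" if "x < y" "y < x + 2 * pi" for x y
    using that sin_gt_zero[of "(y - x) / 2"] sin_minus[of "(y - x) / 2"] by (auto simp: minus_divide_left)
  have sph: "dist z (?p i) = r" for i
    using r by (simp add: circle_point_def dist_norm norm_mult)
  show ?thesis
  proof (rule paths_with_crossing_chords_meet[OF f g sph sph sph sph])
    have "(\<i> * (?p b - ?p d)) \<bullet> (?p a - ?p d) < 0" "0 < (\<i> * (?p b - ?p d)) \<bullet> (?p c - ?p d)"
      unfolding side chord_side using r less
      by (auto simp: sin_pos zero_less_mult_iff mult_less_0_iff)
    then show "(\<i> * (?p b - ?p d)) \<bullet> (?p a - ?p b) < 0" "0 < (\<i> * (?p b - ?p d)) \<bullet> (?p c - ?p b)"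
      by (simp_all only: side'[of b d])
    show "(\<i> * (?p c - ?p a)) \<bullet> (?p b - ?p a) < 0" "0 < (\<i> * (?p c - ?p a)) \<bullet> (?p d - ?p a)"
      unfolding side chord_side using r less
      by (auto simp: sin_pos zero_less_mult_iff mult_less_0_iff)
  qed (use that in blast)
qed

lemma circle_point_eq_iff:
  assumes "0 < r"
  shows "circle_point z r \<theta> = circle_point z r \<eta> \<longleftrightarrow> (\<exists>n::int. \<theta> = \<eta> + 2 * pi * of_int n)"
  using assms sin_cos_eq_iff[of \<theta> \<eta>] by (auto simp: circle_point_def complex_eq_iff)

lemma circle_point_add_2pi:
  "circle_point z r (\<theta> + 2 * pi) = circle_point z r \<theta>"
  "circle_point z r (2 * pi + \<theta>) = circle_point z r \<theta>"
  by (simp_all add: circle_point_def flip: cis_mult)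

lemma circle_point_eqD:
  assumes "0 < r" "circle_point z r \<theta> = circle_point z r \<eta>" "\<bar>\<theta> - \<eta>\<bar> < 2 * pi"
  shows "\<theta> = \<eta>"
proof -
  obtain n :: int where n: "\<theta> = \<eta> + 2 * pi * of_int n"
    using assms circle_point_eq_iff by blast
  then have "2 * pi * \<bar>of_int n\<bar> < 2 * pi * 1" using assms(3) by (simp add: abs_mult)
  then have "\<bar>n\<bar> < 1" by (simp only: mult_less_cancel_left_pos pi_gt_zero mult_pos_pos)
  then show ?thesis using n by simp
qed

lemma inj_on_circle_point:
  assumes "0 < r" shows "inj_on (circle_point z r) {a..<a + 2 * pi}"
  by (rule inj_onI, rule circle_point_eqD[OF assms]) auto

lemma sphere_eq_circle_point_image:
  assumes "0 < r" shows "sphere z r = circle_point z r ` {a..<a + 2 * pi}"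
proof (intro subset_antisym subsetI)
  fix x assume "x \<in> sphere z r"
  then have "cmod ((x - z) / of_real r) = 1"
    using assms by (simp add: dist_norm norm_divide norm_minus_commute)
  then obtain t where "(x - z) / of_real r = Complex (cos t) (sin t)"
    using complex_unimodular_polar by metis
  then have t: "x = circle_point z r t"
    using assms by (simp add: circle_point_def cis.ctr field_simps)
  \<comment> \<open>The number of full turns that separates \<open>t\<close> from the window
    starting at \<open>a\<close>.\<close>
  define n where "n = \<lfloor>(t - a) / (2 * pi)\<rfloor>"
  have "of_int n \<le> (t - a) / (2 * pi)" "(t - a) / (2 * pi) < of_int n + 1"
    unfolding n_def by linarith+
  then have "2 * pi * of_int n \<le> t - a" "t - a < 2 * pi * of_int n + 2 * pi"
    by (simp_all add: field_simps)
  moreover have "circle_point z r (t - 2 * pi * of_int n) = x"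
    unfolding t circle_point_eq_iff[OF assms] by (intro exI[of _ "- n"]) simp
  ultimately show "x \<in> circle_point z r ` {a..<a + 2 * pi}"
    by (intro image_eqI[of _ _ "t - 2 * pi * of_int n"]) auto
qed (use assms in \<open>auto simp: circle_point_def dist_norm norm_mult\<close>)

lemma circle_arc_half_open:
  assumes "a < b" "b \<le> a + 2 * pi"
  shows "circle_arc z r (circle_point z r ` {a..<b})"
  unfolding circle_arc_def circle_point_def using assms by blast

section \<open>Connectivity patterns of drawn digraphs\<close>

text \<open>Only one orientation of the two chords is mentioned: the others arise by adding \<open>2\<pi>\<close> to some
  of the angles.\<close>

definition circular_patterns :: "complex \<Rightarrow> real \<Rightarrow> complex set \<Rightarrow> (complex \<times> complex) set set" where
  "circular_patterns z r T = {P. P \<subseteq> T \<times> T \<and> Id_on T \<subseteq> P \<and> trans P \<and>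
     (\<forall>a b c d. a < b \<and> b < c \<and> c < d \<and> d < a + 2 * pi \<and>
        (circle_point z r a, circle_point z r c) \<in> P \<and> (circle_point z r b, circle_point z r d) \<in> P \<longrightarrow>
        (circle_point z r a, circle_point z r d) \<in> P \<and> (circle_point z r b, circle_point z r c) \<in> P)}"

lemma circular_patternsD:
  assumes "P \<in> circular_patterns z r T"
  shows "(s, t) \<in> P \<Longrightarrow> s \<in> T" "(s, t) \<in> P \<Longrightarrow> t \<in> T" "s \<in> T \<Longrightarrow> (s, s) \<in> P"
    "(s, t) \<in> P \<Longrightarrow> (t, u) \<in> P \<Longrightarrow> (s, u) \<in> P"
  using assms unfolding circular_patterns_def by (blast, blast, blast, blast dest: transD)

lemma circular_patterns_cross:
  assumes "P \<in> circular_patterns z r T"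
    and "(circle_point z r a, circle_point z r c) \<in> P" "(circle_point z r b, circle_point z r d) \<in> P"
    and "a < b" "b < c" "c < d" "d < a + 2 * pi"
  shows "(circle_point z r a, circle_point z r d) \<in> P" "(circle_point z r b, circle_point z r c) \<in> P"
  using assms unfolding circular_patterns_def by blast+

section \<open>Walks and the curves that draw them\<close>

lemma (in wf_digraph) adj_arcE:
  assumes "u \<rightarrow>\<^bsub>G\<^esub> v"
  obtains e where "e \<in> arcs G" "tail G e = u" "head G e = v"
  using assms by (auto simp: arcs_ends_conv)

lemma (in wf_digraph) arc_reachable: "e \<in> arcs G \<Longrightarrow> tail G e \<rightarrow>\<^sup>*\<^bsub>G\<^esub> head G e"
  by (intro reachable_adjI) (auto simp: arcs_ends_conv)

text \<open>The point \<open>x\<close> of the plane lies on the drawing of some walk from \<open>s\<close> to \<open>t\<close>.\<close>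

definition traced :: "('a, real \<Rightarrow> 'a::topological_space) pre_digraph \<Rightarrow> 'a \<Rightarrow> 'a \<Rightarrow> 'a \<Rightarrow> bool" where
  "traced G s t x \<longleftrightarrow> (s \<rightarrow>\<^sup>*\<^bsub>G\<^esub> x \<and> x \<rightarrow>\<^sup>*\<^bsub>G\<^esub> t) \<or>
     (\<exists>e\<in>arcs G. x \<in> path_image e \<and> s \<rightarrow>\<^sup>*\<^bsub>G\<^esub> tail G e \<and> head G e \<rightarrow>\<^sup>*\<^bsub>G\<^esub> t)"

lemma drawn_digraphD:
  assumes "drawn_digraph D G"
  shows "fin_digraph G" "verts G \<subseteq> D"
    "e \<in> arcs G \<Longrightarrow> path e" "e \<in> arcs G \<Longrightarrow> path_image e \<subseteq> D"
    "e \<in> arcs G \<Longrightarrow> pathstart e = tail G e" "e \<in> arcs G \<Longrightarrow> pathfinish e = head G e"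
    "e \<in> arcs G \<Longrightarrow> path_image e \<inter> verts G = {tail G e, head G e}"
    "e \<in> arcs G \<Longrightarrow> f \<in> arcs G \<Longrightarrow> e \<noteq> f \<Longrightarrow> path_image e \<inter> path_image f \<subseteq> verts G"
  using assms unfolding drawn_digraph_def simple_path_def by simp_all

text \<open>Induction on reachability, appending the curve of the last arc. The curve may cross
  itself; what has to be kept is how the walk passes each of its points.\<close>

lemma reachable_traced_by_path:
  assumes G: "drawn_digraph D G" and st: "s \<rightarrow>\<^sup>*\<^bsub>G\<^esub> t"
  obtains h where "path h" "path_image h \<subseteq> D" "pathstart h = s" "pathfinish h = t"
    "\<And>x. x \<in> path_image h \<Longrightarrow> traced G s t x"
proof -
  interpret fin_digraph G using drawn_digraphD(1)[OF G] .
  have "\<exists>h. path h \<and> path_image h \<subseteq> D \<and> pathstart h = s \<and> pathfinish h = t \<and>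
      (\<forall>x\<in>path_image h. traced G s t x)"
    using st
  proof (induction rule: reachable_induct)
    case base
    then show ?case
      using drawn_digraphD(2)[OF G] by (intro exI[of _ "linepath s s"]) (auto simp: traced_def path_def pathstart_def pathfinish_def)
  next
    case (step y t)
    then obtain h where h: "path h" "path_image h \<subseteq> D" "pathstart h = s" "pathfinish h = y"
      "\<forall>x\<in>path_image h. traced G s y x" by blast
    obtain e where e: "e \<in> arcs G" "tail G e = y" "head G e = t"
      using adj_arcE[OF step(2)] .
    note drawn = drawn_digraphD[OF G]
    have yt: "y \<rightarrow>\<^sup>*\<^bsub>G\<^esub> t" using arc_reachable e by blast
    have img: "path_image (h +++ e) = path_image h \<union> path_image e"
      using h(4) drawn(5)[OF e(1)] e(2) by (intro path_image_join) simp
    have "traced G s t x" if "x \<in> path_image h" for x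
      using h(5) that yt reachable_trans unfolding traced_def by blast
    moreover have "traced G s t x" if "x \<in> path_image e" for x
      using that e step(1) reachable_refl[of t] reachable_in_verts(2)[OF yt]
      unfolding traced_def by blast
    ultimately show ?case
      using h drawn(3-6)[OF e(1)] e(2,3) img by (intro exI[of _ "h +++ e"]) auto
  qed
  then show ?thesis using that by blast
qed

text \<open>Distinct arcs meet only in vertices, so a common point is either a vertex of both walks
  or lies inside one arc used by both. Either way it is possible to switch walks there.\<close>

lemma traced_common_point:
  assumes G: "drawn_digraph D G" and x: "traced G s t x" "traced G u v x"
  shows "s \<rightarrow>\<^sup>*\<^bsub>G\<^esub> v" "u \<rightarrow>\<^sup>*\<^bsub>G\<^esub> t"
proof -
  interpret fin_digraph G using drawn_digraphD(1)[OF G] .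
  have vert: "p \<rightarrow>\<^sup>*\<^bsub>G\<^esub> x \<and> x \<rightarrow>\<^sup>*\<^bsub>G\<^esub> q" if "traced G p q x" "x \<in> verts G" for p q
    using that(1) unfolding traced_def
  proof (elim disjE bexE conjE)
    fix e assume e: "e \<in> arcs G" "x \<in> path_image e" "p \<rightarrow>\<^sup>*\<^bsub>G\<^esub> tail G e" "head G e \<rightarrow>\<^sup>*\<^bsub>G\<^esub> q"
    then have "x = tail G e \<or> x = head G e" using drawn_digraphD(7)[OF G e(1)] that(2) by blast
    then show ?thesis using e arc_reachable[OF e(1)] reachable_trans by blast
  qed blast
  have "s \<rightarrow>\<^sup>*\<^bsub>G\<^esub> v \<and> u \<rightarrow>\<^sup>*\<^bsub>G\<^esub> t"
  proof (cases "x \<in> verts G")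
    case True
    then show ?thesis using vert x reachable_trans by blast
  next
    case False
    then have "\<not> p \<rightarrow>\<^sup>*\<^bsub>G\<^esub> x" for p using reachable_in_verts by blast
    then obtain e f where
      e: "e \<in> arcs G" "x \<in> path_image e" "s \<rightarrow>\<^sup>*\<^bsub>G\<^esub> tail G e" "head G e \<rightarrow>\<^sup>*\<^bsub>G\<^esub> t" and
      f: "f \<in> arcs G" "x \<in> path_image f" "u \<rightarrow>\<^sup>*\<^bsub>G\<^esub> tail G f" "head G f \<rightarrow>\<^sup>*\<^bsub>G\<^esub> v"
      using x unfolding traced_def by blast
    have "e = f" using drawn_digraphD(8)[OF G e(1) f(1)] e(2) f(2) False by blast
    then show ?thesis using e(3,4) f(3,4) arc_reachable[OF e(1)] reachable_trans by blast
  qed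
  then show "s \<rightarrow>\<^sup>*\<^bsub>G\<^esub> v" "u \<rightarrow>\<^sup>*\<^bsub>G\<^esub> t" by blast+
qed

lemma connectivity_pattern_circular:
  assumes r: "0 < r" and G: "drawn_digraph (cball z r) G" and T: "T \<subseteq> verts G"
  shows "connectivity_pattern G T \<in> circular_patterns z r T"
proof -
  interpret fin_digraph G using drawn_digraphD(1)[OF G] .
  have P: "(s, t) \<in> connectivity_pattern G T \<longleftrightarrow> s \<in> T \<and> t \<in> T \<and> s \<rightarrow>\<^sup>*\<^bsub>G\<^esub> t" for s t
    by (simp add: connectivity_pattern_def reachable_apath)
  let ?p = "circle_point z r"
  have "?p a \<rightarrow>\<^sup>*\<^bsub>G\<^esub> ?p d \<and> ?p b \<rightarrow>\<^sup>*\<^bsub>G\<^esub> ?p c"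
    if less: "a < b" "b < c" "c < d" "d < a + 2 * pi"
      and ac: "?p a \<rightarrow>\<^sup>*\<^bsub>G\<^esub> ?p c" and bd: "?p b \<rightarrow>\<^sup>*\<^bsub>G\<^esub> ?p d" for a b c d
  proof -
    obtain h where h: "path h" "path_image h \<subseteq> cball z r" "pathstart h = ?p a" "pathfinish h = ?p c"
      and h': "\<And>x. x \<in> path_image h \<Longrightarrow> traced G (?p a) (?p c) x"
      by (rule reachable_traced_by_path[OF G ac]) blast
    obtain k where k: "path k" "path_image k \<subseteq> cball z r" "pathstart k = ?p b" "pathfinish k = ?p d"
      and k': "\<And>x. x \<in> path_image k \<Longrightarrow> traced G (?p b) (?p d) x"
      by (rule reachable_traced_by_path[OF G bd]) blast
    obtain x where "x \<in> path_image h" "x \<in> path_image k"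
      by (rule paths_with_interleaved_ends_meet[OF r less h k])
    then show ?thesis using traced_common_point[OF G h' k'] by blast
  qed
  moreover have "trans (connectivity_pattern G T)"
    by (rule transI) (use P reachable_trans in blast)
  \<comment> \<open>Reachability is reflexive only at vertices, hence the appeal to
    \<open>T\<close>.\<close>
  moreover have "Id_on T \<subseteq> connectivity_pattern G T" using P T by auto
  ultimately show ?thesis
    unfolding circular_patterns_def using P by auto
qed

text \<open>If \<open>s\<close> does not reach \<open>t\<close>, the arc spanned by all points reachable from \<open>s\<close> and avoiding \<open>t\<close>
  is closed under reachability, so it is a cut without an arc of \<open>P\<close>.\<close>

lemma gen_circular_pattern:
  assumes r: "0 < r" and T: "finite T" "T \<subseteq> sphere z r" and P: "P \<in> circular_patterns z r T"
  shows "gen z r T P = P"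
proof (intro subset_antisym subrelI)
  fix s t assume "(s, t) \<in> P"
  then show "(s, t) \<in> gen z r T P" using circular_patternsD(1,2)[OF P] by (auto simp: gen_def)
next
  let ?p = "circle_point z r"
  fix s t assume st: "(s, t) \<in> gen z r T P"
  then have "s \<in> T" "t \<in> T" by (auto simp: gen_def)
  show "(s, t) \<in> P"
  proof (rule ccontr)
    assume not: "(s, t) \<notin> P"
    have angle: "\<exists>\<theta>\<in>{a..<a + 2 * pi}. x = ?p \<theta>" if "x \<in> T" for x a
      using that T(2) sphere_eq_circle_point_image[OF r, of z a] by blast
    obtain \<tau> where \<tau>: "t = ?p \<tau>" using angle \<open>t \<in> T\<close> by blast
    \<comment> \<open>The circle is cut open at \<open>t\<close>, which sits at both excluded ends
      of the window.\<close>
    define \<Theta> where "\<Theta> = {\<theta>. \<tau> < \<theta> \<and> \<theta> < \<tau> + 2 * pi \<and> ?p \<theta> \<in> T}"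
    define A where "A = {\<theta> \<in> \<Theta>. (s, ?p \<theta>) \<in> P}"
    have "finite \<Theta>"
    proof (rule finite_imageD)
      show "finite (?p ` \<Theta>)" by (rule finite_subset[OF _ T(1)]) (auto simp: \<Theta>_def)
      show "inj_on ?p \<Theta>" by (rule inj_on_subset[OF inj_on_circle_point[OF r, of z \<tau>]]) (auto simp: \<Theta>_def)
    qed
    then have "finite A" by (simp add: A_def)
    have angle': "\<exists>\<theta>\<in>\<Theta>. x = ?p \<theta>" if x: "x \<in> T" "x \<noteq> t" for x
    proof -
      obtain \<theta> where "\<tau> \<le> \<theta>" "\<theta> < \<tau> + 2 * pi" "x = ?p \<theta>" using angle[OF x(1), of \<tau>] by auto
      moreover have "\<theta> \<noteq> \<tau>" using calculation x(2) \<tau> by auto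
      ultimately show ?thesis using x(1) by (intro bexI[of _ \<theta>]) (auto simp: \<Theta>_def)
    qed
    have "s \<noteq> t" using not circular_patternsD(3)[OF P \<open>s \<in> T\<close>] by auto
    then obtain \<sigma> where \<sigma>: "\<sigma> \<in> \<Theta>" "s = ?p \<sigma>" using angle' \<open>s \<in> T\<close> by blast
    have "\<sigma> \<in> A" using \<sigma> circular_patternsD(3)[OF P \<open>s \<in> T\<close>] by (auto simp: A_def)
    define \<alpha> where "\<alpha> = Min A"
    define \<omega> where "\<omega> = Max A"
    \<comment> \<open>The next point of \<open>T\<close> after \<open>\<omega>\<close>, or
      \<open>t\<close> one turn later. The half-open arc from \<open>\<alpha>\<close> to
      \<open>\<beta>\<close> then has no point of \<open>T\<close> after \<open>\<omega>\<close> and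
      leaves \<open>t\<close> to its complement.\<close>
    define \<beta> where "\<beta> = Min (insert (\<tau> + 2 * pi) {\<theta> \<in> \<Theta>. \<omega> < \<theta>})"
    have A: "\<alpha> \<in> A" "\<omega> \<in> A" "\<And>\<theta>. \<theta> \<in> A \<Longrightarrow> \<alpha> \<le> \<theta> \<and> \<theta> \<le> \<omega>"
      using \<open>finite A\<close> \<open>\<sigma> \<in> A\<close> unfolding \<alpha>_def \<omega>_def by (auto intro: Min_in Max_in)
    have in_\<Theta>: "\<tau> < \<theta>" "\<theta> < \<tau> + 2 * pi" "?p \<theta> \<in> T" if "\<theta> \<in> \<Theta>" for \<theta>
      using that by (auto simp: \<Theta>_def)
    have \<alpha>: "\<tau> < \<alpha>" "\<alpha> \<le> \<sigma>" and \<omega>: "\<sigma> \<le> \<omega>" "\<omega> < \<tau> + 2 * pi"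
      using A \<open>\<sigma> \<in> A\<close> in_\<Theta> by (auto simp: A_def)
    have "\<beta> \<le> \<tau> + 2 * pi" and \<beta>_le: "\<And>\<theta>. \<theta> \<in> \<Theta> \<Longrightarrow> \<omega> < \<theta> \<Longrightarrow> \<beta> \<le> \<theta>"
      using \<open>finite \<Theta>\<close> unfolding \<beta>_def by auto
    have "\<omega> < \<beta>" using \<open>finite \<Theta>\<close> \<omega>(2) unfolding \<beta>_def by (subst Min_gr_iff) auto
    define Xs where "Xs = ?p ` {\<alpha>..<\<beta>}"
    define Xt where "Xt = ?p ` {\<beta> - 2 * pi..<\<alpha>}"
    have "circle_arc z r Xs" "circle_arc z r Xt"
      unfolding Xs_def Xt_def using \<alpha> \<omega> \<open>\<omega> < \<beta>\<close> \<open>\<beta> \<le> \<tau> + 2 * pi\<close>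
      by (auto intro!: circle_arc_half_open)
    moreover have "Xs \<union> Xt = sphere z r"
    proof -
      have "{\<beta> - 2 * pi..<\<beta> - 2 * pi + 2 * pi} = {\<alpha>..<\<beta>} \<union> {\<beta> - 2 * pi..<\<alpha>}"
        using \<alpha> \<omega> \<open>\<omega> < \<beta>\<close> \<open>\<beta> \<le> \<tau> + 2 * pi\<close> by auto
      then show ?thesis
        unfolding Xs_def Xt_def sphere_eq_circle_point_image[OF r, of z "\<beta> - 2 * pi"] by (simp only: image_Un)
    qed
    moreover have "Xs \<inter> Xt = {}"
    proof -
      have "\<theta> \<noteq> \<eta> \<and> \<bar>\<theta> - \<eta>\<bar> < 2 * pi" if "\<theta> \<in> {\<alpha>..<\<beta>}" "\<eta> \<in> {\<beta> - 2 * pi..<\<alpha>}" for \<theta> \<eta>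
        using that by auto
      then show ?thesis unfolding Xs_def Xt_def using circle_point_eqD[OF r] by blast
    qed
    moreover have "s \<in> Xs"
      unfolding Xs_def \<sigma>(2) using \<alpha> \<omega> \<open>\<omega> < \<beta>\<close> by auto
    moreover have "t \<in> Xt"
      unfolding Xt_def \<tau> using \<alpha> \<open>\<beta> \<le> \<tau> + 2 * pi\<close> by auto
    ultimately have "\<exists>s'\<in>Xs. \<exists>t'\<in>Xt. (s', t') \<in> P"
      using st unfolding gen_def by blast
    then obtain \<theta> \<eta> where \<theta>: "\<alpha> \<le> \<theta>" "\<theta> < \<beta>" and \<eta>: "\<beta> - 2 * pi \<le> \<eta>" "\<eta> < \<alpha>"
      and \<theta>\<eta>: "(?p \<theta>, ?p \<eta>) \<in> P"
      unfolding Xs_def Xt_def by auto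
    have \<eta>': "(?p \<theta>, ?p (\<eta> + 2 * pi)) \<in> P" using \<theta>\<eta> by (simp add: circle_point_add_2pi)
    have "\<theta> \<in> \<Theta>"
      using \<theta> \<alpha> \<open>\<beta> \<le> \<tau> + 2 * pi\<close> circular_patternsD(1)[OF P \<theta>\<eta>] by (auto simp: \<Theta>_def)
    then have "\<theta> \<le> \<omega>" using \<beta>_le[of \<theta>] \<theta>(2) by force
    have "(s, ?p \<eta>) \<in> P"
    proof -
      \<comment> \<open>If \<open>s\<close> does not reach the source at \<open>\<theta>\<close>,
        this source lies strictly between \<open>s\<close> and an extreme reached point, and the
        pair leaving the arc crosses the pair from \<open>s\<close> to that extreme.\<close>
      consider "(s, ?p \<theta>) \<in> P" | "\<alpha> < \<theta>" "\<theta> < \<sigma>" | "\<sigma> < \<theta>" "\<theta> < \<omega>"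
        using A(1,2) \<sigma> \<theta>(1) \<open>\<theta> \<le> \<omega>\<close> \<open>\<sigma> \<in> A\<close>
        by (cases \<theta> \<sigma> rule: linorder_cases) (auto simp: A_def order.order_iff_strict)
      then show ?thesis
      proof cases
        case 1
        then show ?thesis using \<theta>\<eta> circular_patternsD(4)[OF P] by blast
      next
        case 2
        have "(?p \<sigma>, ?p (\<alpha> + 2 * pi)) \<in> P" using A(1) \<sigma>(2) by (simp add: A_def circle_point_add_2pi)
        then have "(?p \<sigma>, ?p (\<eta> + 2 * pi)) \<in> P"
          using circular_patterns_cross(2)[OF P \<eta>' _ 2(2), of "\<alpha> + 2 * pi"] 2 \<eta> \<omega> \<open>\<omega> < \<beta>\<close> by auto
        then show ?thesis by (simp add: \<sigma>(2) circle_point_add_2pi)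
      next
        case 3
        have "(?p \<sigma>, ?p \<omega>) \<in> P" using A(2) \<sigma>(2) by (simp add: A_def)
        then have "(?p \<sigma>, ?p (\<eta> + 2 * pi)) \<in> P"
          using circular_patterns_cross(1)[OF P _ \<eta>', of \<sigma> \<omega>] 3 \<eta> \<alpha> \<open>\<omega> < \<beta>\<close> by auto
        then show ?thesis by (simp add: \<sigma>(2) circle_point_add_2pi)
      qed
    qed
    then have "?p \<eta> \<noteq> t" "?p \<eta> \<in> T" using not circular_patternsD(2)[OF P] by auto
    \<comment> \<open>The reached point at \<open>\<eta>\<close> lies before \<open>\<alpha>\<close>
      or, after a full turn past the cut, beyond \<open>\<omega>\<close>; both contradict
      extremality.\<close>
    show False
    proof (cases "\<tau> < \<eta>")
      case True
      then have "\<eta> \<in> A"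
        using \<open>(s, ?p \<eta>) \<in> P\<close> \<open>?p \<eta> \<in> T\<close> \<eta> \<alpha> \<omega> by (auto simp: A_def \<Theta>_def)
      then show False using A(3) \<eta>(2) by force
    next
      case False
      moreover have "\<eta> \<noteq> \<tau>" using \<open>?p \<eta> \<noteq> t\<close> \<tau> by auto
      ultimately have "\<eta> + 2 * pi \<in> A"
        using \<open>(s, ?p \<eta>) \<in> P\<close> \<open>?p \<eta> \<in> T\<close> \<eta> \<omega> \<alpha> \<open>\<omega> < \<beta>\<close>
        by (auto simp: A_def \<Theta>_def circle_point_add_2pi)
      then show False using A(3) \<eta>(1) \<open>\<omega> < \<beta>\<close> by force
    qed
  qed
qed

section \<open>Counting circular patterns\<close>

lemma circular_pattern_forward:
  assumes P: "P \<in> circular_patterns z r T" and V: "V \<subseteq> {0..<2 * pi}"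
  shows "{(a, b) \<in> V \<times> V. a < b \<and> (circle_point z r a, circle_point z r b) \<in> P} \<in> forward_patterns V"
    (is "?F \<in> _")
proof -
  have trans: "trans ?F" by (rule transI) (use circular_patternsD(4)[OF P] in auto)
  have cross: "(a, d) \<in> ?F \<and> (b, c) \<in> ?F"
    if *: "a < b" "b < c" "c < d" "(a, c) \<in> ?F" "(b, d) \<in> ?F" for a b c d
  proof -
    have "d < a + 2 * pi" using * subsetD[OF V, of a] subsetD[OF V, of d] by auto
    then show ?thesis using * circular_patterns_cross[OF P, of a c b d] by auto
  qed
  show ?thesis
    by (rule forward_patternsI[OF _ _ trans cross]) auto
qed

text \<open>Shifting the two targets by a full turn gives the increasing angles \<open>- b\<close>,
  \<open>- a\<close>, \<open>- d + 2 * pi\<close>, \<open>- c + 2 * pi\<close>, to which the one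
  stated orientation of the crossing rule applies.\<close>

lemma circular_pattern_backward:
  assumes P: "P \<in> circular_patterns z r T" and V: "V \<subseteq> {0..<2 * pi}"
  shows "{(a, b) \<in> uminus ` V \<times> uminus ` V. a < b \<and>
    (circle_point z r (- a), circle_point z r (- b)) \<in> P} \<in> forward_patterns (uminus ` V)"
    (is "?F \<in> _")
proof -
  have trans: "trans ?F" by (rule transI) (use circular_patternsD(4)[OF P] in auto)
  have cross: "(a, d) \<in> ?F \<and> (b, c) \<in> ?F"
    if *: "a < b" "b < c" "c < d" "(a, c) \<in> ?F" "(b, d) \<in> ?F" for a b c d
  proof -
    have "- a < - d + 2 * pi"
      using * subsetD[OF V, of "- a"] subsetD[OF V, of "- d"] by auto
    moreover have "(circle_point z r (- b), circle_point z r (- d + 2 * pi)) \<in> P"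
      "(circle_point z r (- a), circle_point z r (- c + 2 * pi)) \<in> P"
      using * by (auto simp: circle_point_add_2pi)
    ultimately have "(circle_point z r (- b), circle_point z r (- c + 2 * pi)) \<in> P"
      "(circle_point z r (- a), circle_point z r (- d + 2 * pi)) \<in> P"
      using circular_patterns_cross[OF P, of "- b" "- d + 2 * pi" "- a" "- c + 2 * pi"] * by auto
    then show ?thesis using * by (auto simp: circle_point_add_2pi)
  qed
  show ?thesis
    by (rule forward_patternsI[OF _ _ trans cross]) auto
qed

lemma finite_forward_patterns: "finite V \<Longrightarrow> finite (forward_patterns V)"
  by (rule finite_subset[of _ "Pow (V \<times> V)"]) (auto simp: forward_patterns_def)

text \<open>The diagonal is fixed, so the pairs of increasing and of decreasing angle determine the
  pattern. Each half costs 512, or nine bits, per point.\<close>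

lemma card_circular_patterns:
  assumes r: "0 < r" and T: "finite T" "T \<subseteq> sphere z r"
  shows "card (circular_patterns z r T) \<le> 2 ^ (18 * card T)"
proof -
  let ?p = "circle_point z r"
  define V where "V = {\<theta> \<in> {0..<2 * pi}. ?p \<theta> \<in> T}"
  have V: "V \<subseteq> {0..<2 * pi}" by (auto simp: V_def)
  have inj: "inj_on ?p V"
    using inj_on_subset[OF inj_on_circle_point[OF r, of z 0]] V by simp
  have img: "?p ` V = T"
    using T(2) sphere_eq_circle_point_image[OF r, of z 0] by (auto simp: V_def)
  have "finite V" using finite_imageD[OF _ inj] img T(1) by simp
  have card_V: "card V = card T" using card_image[OF inj] img by simp
  let ?F = "\<lambda>P. {(a, b) \<in> V \<times> V. a < b \<and> (?p a, ?p b) \<in> P}"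
  let ?B = "\<lambda>P. {(a, b) \<in> uminus ` V \<times> uminus ` V. a < b \<and> (?p (- a), ?p (- b)) \<in> P}"
  have le: "P \<subseteq> Q" if P: "P \<in> circular_patterns z r T" and Q: "Q \<in> circular_patterns z r T"
    and eq: "?F P = ?F Q" "?B P = ?B Q" for P Q
  proof (rule subrelI)
    fix s t assume st: "(s, t) \<in> P"
    then obtain a b where ab: "a \<in> V" "b \<in> V" "s = ?p a" "t = ?p b"
      using circular_patternsD(1,2)[OF P] img by blast
    consider "a < b" | "a = b" | "- a < - b" by fastforce
    then show "(s, t) \<in> Q"
    proof cases
      case 1
      then have "(a, b) \<in> ?F P" using st ab by simp
      then show ?thesis unfolding eq using ab by simp
    next
      case 2
      then show ?thesis using circular_patternsD(3)[OF Q] circular_patternsD(1)[OF P st] ab by simp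
    next
      case 3
      then have "(- a, - b) \<in> ?B P" using st ab by simp
      then show ?thesis unfolding eq using ab by simp
    qed
  qed
  have "inj_on (\<lambda>P. (?F P, ?B P)) (circular_patterns z r T)"
    by (rule inj_onI, rule subset_antisym) (rule le, simp_all)+
  moreover have "(\<lambda>P. (?F P, ?B P)) ` circular_patterns z r T
      \<subseteq> forward_patterns V \<times> forward_patterns (uminus ` V)"
    using circular_pattern_forward[OF _ V] circular_pattern_backward[OF _ V] by blast
  ultimately have "card (circular_patterns z r T)
      \<le> card (forward_patterns V \<times> forward_patterns (uminus ` V))"
    using \<open>finite V\<close> by (intro card_inj_on_le) (simp_all add: finite_forward_patterns)
  also have "\<dots> \<le> 512 ^ card V * 512 ^ card V"
    using card_forward_patterns[OF \<open>finite V\<close>] card_forward_patterns[of "uminus ` V"] \<open>finite V\<close>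
    by (auto simp: card_cartesian_product card_image intro!: mult_mono)
  also have "\<dots> = (2 ^ 18) ^ card V" by (simp flip: power_mult_distrib)
  finally show ?thesis by (simp only: card_V power_mult)
qed

theorem theorem13:
  shows "\<exists>f :: nat \<Rightarrow> real. f \<in> O(\<lambda>n. real n) \<and>
    (\<forall>(n :: nat) (c :: complex) (r :: real) (T :: complex set).
       r > 0 \<and> finite T \<and> card T = n \<and> T \<subseteq> sphere c r \<longrightarrow>
       (\<exists>\<R> :: (complex \<times> complex) set set.
          (\<forall>R\<in>\<R>. R \<subseteq> T \<times> T) \<and> real (card \<R>) \<le> 2 powr f n \<and>
          (\<forall>G. drawn_digraph (cball c r) G \<and> T \<subseteq> verts G \<longrightarrow>
             (\<exists>R\<in>\<R>. connectivity_pattern G T = gen c r T R))))"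
proof (intro exI[of _ "\<lambda>n. 18 * real n"] conjI allI impI)
  show "(\<lambda>n. 18 * real n) \<in> O(\<lambda>n. real n)" by simp
next
  fix n :: nat and z :: complex and r :: real and T :: "complex set"
  assume *: "r > 0 \<and> finite T \<and> card T = n \<and> T \<subseteq> sphere z r"
  show "\<exists>\<R>. (\<forall>R\<in>\<R>. R \<subseteq> T \<times> T) \<and> real (card \<R>) \<le> 2 powr (18 * real n) \<and>
     (\<forall>G. drawn_digraph (cball z r) G \<and> T \<subseteq> verts G \<longrightarrow>
        (\<exists>R\<in>\<R>. connectivity_pattern G T = gen z r T R))"
  \<comment> \<open>Each pattern generates itself, so the circular patterns form the family.\<close>
  proof (intro exI[of _ "circular_patterns z r T"] conjI)
    show "\<forall>R\<in>circular_patterns z r T. R \<subseteq> T \<times> T" by (auto simp: circular_patterns_def)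
    have "real (card (circular_patterns z r T)) \<le> real (2 ^ (18 * n))"
      using card_circular_patterns[of r T z] * by (simp only: of_nat_le_iff)
    also have "\<dots> = 2 powr (18 * real n)"
      using powr_realpow[of "2::real" "18 * n"] by simp
    finally show "real (card (circular_patterns z r T)) \<le> 2 powr (18 * real n)" .
    show "\<forall>G. drawn_digraph (cball z r) G \<and> T \<subseteq> verts G \<longrightarrow>
        (\<exists>R\<in>circular_patterns z r T. connectivity_pattern G T = gen z r T R)"
      using * connectivity_pattern_circular gen_circular_pattern by metis
  qed
qed

end
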